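(* Let $K\subset\mathbb{R}^2$ be a compact convex set with more than one point that is lattice-free. Then (i) $\displaystyle\frac{\mathrm{D}(K)-1}{\mathrm{D}(K)}\bigl(\mathrm{p}(K)-2\,\mathrm{D}(K)\bigr)<2$, (ii) $\displaystyle\frac{2\,\mathrm{R}(K)-1}{2\,\mathrm{R}(K)}\bigl(\mathrm{p}(K)-4\,\mathrm{R}(K)\bigr)<2$. None of the inequalities can be improved, i.e. in each of (i) and (ii) the constant $2$ on the right-hand side cannot be replaced by any smaller constant valid for all such $K$.
   Context: For a planar convex body $K$ (nonempty compact convex subset of $\mathbb{R}^2$), $\mathrm{p}(K)$ denotes its perimeter, $\mathrm{D}(K)$ its diameter and $\mathrm{R}(K)$ its circumradius (the radius of the smallest Euclidean disk containing $K$), all with respect to the Euclidean norm. The perimeter of a line segment is, by the usual convention, twice its length. $K$ is called lattice-free if its interior contains no point of the integer lattice $\mathbb{Z}^2$. *)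

theory Defs
  imports "HOL-Analysis.Analysis"
begin

text \<open>The parameters \<open>t 0 \<le> \<dots> \<le> t n\<close> subdivide \<open>[0,1]\<close>, so this is the supremum of the
  lengths of the inscribed polygonal curves. It is meaningful for rectifiable \<open>g\<close> only; boundary
  curves of bounded convex sets are rectifiable.\<close>

definition curve_length :: "(real \<Rightarrow> 'a::metric_space) \<Rightarrow> real" where
  "curve_length g =
     Sup {\<Sum>i<n. dist (g (t i)) (g (t (Suc i))) | (n::nat) (t::nat \<Rightarrow> real).
            t 0 = 0 \<and> t n = 1 \<and> mono_on {..n} t}"

definition boundary_parametrization :: "(real^2) set \<Rightarrow> (real \<Rightarrow> real^2) \<Rightarrow> bool" where
  "boundary_parametrization K g \<longleftrightarrow>
     simple_path g \<and> pathfinish g = pathstart g \<and> path_image g = frontier K"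

text \<open>A compact convex subset of the plane with empty interior is a segment (or a point, or
  empty), whose diameter is its length. Otherwise the perimeter is the length of the boundary
  curve. A simple closed parametrization of it exists by the lemma below, and the length does not
  depend on which one is chosen.\<close>

definition perimeter :: "(real^2) set \<Rightarrow> real" where
  "perimeter K =
     (if interior K = {} then 2 * diameter K
      else curve_length (SOME g. boundary_parametrization K g))"

definition circumradius :: "(real^2) set \<Rightarrow> real" where
  "circumradius K = Inf {r. \<exists>c. K \<subseteq> cball c r}"

definition integer_lattice :: "(real^2) set" where
  "integer_lattice = {x. \<forall>i. x $ i \<in> \<int>}"

definition lattice_free :: "(real^2) set \<Rightarrow> bool" where
  "lattice_free K \<longleftrightarrow> interior K \<inter> integer_lattice = {}"

definition nontrivial_lattice_free_bodies :: "(real^2) set set" where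
  "nontrivial_lattice_free_bodies =
     {K. compact K \<and> convex K \<and> (\<exists>x\<in>K. \<exists>y\<in>K. x \<noteq> y) \<and> lattice_free K}"

lemma boundary_parametrization_exists:
  assumes "compact K" "convex K" "interior K \<noteq> {}"
  shows "\<exists>g. boundary_parametrization K g"
proof -
  have "K homeomorphic cball (0::real^2) 1"
    using homeomorphic_convex_compact_cball[of K 1 0] assms by simp
  then have "frontier K homeomorphic frontier (cball (0::real^2) 1)"
    using assms by (intro homeomorphic_frontiers_same_dimension) (auto simp: compact_imp_closed)
  moreover have "sphere (0::real^2) 1 homeomorphic sphere (0::complex) 1"
    by (intro homeomorphic_spheres_gen) auto
  ultimately have "sphere (0::complex) 1 homeomorphic frontier K"
    by (metis frontier_cball homeomorphic_sym homeomorphic_trans)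
  then obtain f h where fh: "homeomorphism (sphere (0::complex) 1) (frontier K) f h"
    by (auto simp: homeomorphic_def)
  define e where "e = (\<lambda>t::real. cis (2 * pi * t))"
  have im: "path_image e = sphere 0 1"
  proof
    show "path_image e \<subseteq> sphere 0 1"
      by (auto simp: path_image_def e_def)
    show "sphere 0 1 \<subseteq> path_image e"
    proof
      fix z :: complex assume "z \<in> sphere 0 1"
      then have "norm z = 1" by simp
      then obtain s where s: "0 \<le> s" "s < 2*pi" "z = cis s"
        using complex_unimodular_polar[of z] by (metis complex_eq_iff cis.sel complex.sel)
      then have "z = e (s / (2*pi))" "s / (2*pi) \<in> {0..1}"
        by (auto simp: e_def field_simps)
      then show "z \<in> path_image e"
        unfolding path_image_def by blast
    qed
  qed
  have "path e"
    unfolding path_def e_def by (intro continuous_intros)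
  moreover have "loop_free e"
    unfolding loop_free_def
  proof (intro ballI impI)
    fix x y :: real assume xy: "x \<in> {0..1}" "y \<in> {0..1}" "e x = e y"
    then obtain n::int where "2*pi*x = 2*pi*y + 2*pi*n"
      unfolding e_def using sin_cos_eq_iff[of "2*pi*x" "2*pi*y"]
      by (auto simp: complex_eq_iff)
    then have "2*pi*x = 2*pi*(y + n)"
      by (simp only: distrib_left)
    then have n: "x = y + n"
      by simp
    then have "real_of_int n \<le> 1" "-1 \<le> real_of_int n"
      using xy unfolding atLeastAtMost_iff by linarith+
    then have "n = -1 \<or> n = 0 \<or> n = 1" by linarith
    then show "x = y \<or> x = 0 \<and> y = 1 \<or> x = 1 \<and> y = 0"
      using n xy by auto
  qed
  ultimately have "simple_path e" by (simp add: simple_path_def)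
  then have "simple_path (f \<circ> e)"
    using fh im by (intro simple_path_continuous_image)
      (auto simp: homeomorphism_def intro: inj_on_inverseI)
  moreover have "pathfinish (f \<circ> e) = pathstart (f \<circ> e)"
    by (simp add: pathfinish_def pathstart_def e_def)
  moreover have "path_image (f \<circ> e) = frontier K"
    using fh im by (simp add: path_image_compose homeomorphism_def)
  ultimately show ?thesis
    unfolding boundary_parametrization_def by blast
qed

end

theory Submission
  imports Defs "HOL-Real_Asymp.Real_Asymp"
begin

text \<open>If \<open>K\<close> has width at most \<open>b\<close> in some direction, then its boundary has total variation at most
  \<open>2 b\<close> in that direction and \<open>2 D\<close> in the orthogonal one, so \<open>p < 2 D + 2 b\<close>; the inequality is
  strict because \<open>K\<close>, having diameter \<open>D\<close>, cannot fill a rectangle with sides \<open>D\<close> and \<open>b\<close>.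
  By Scott's inequality \<open>(w - 1) (D - 1) \<le> 1\<close> for the minimal width \<open>w\<close>, one may take
  \<open>b = D / (D - 1)\<close> when \<open>D > 1\<close>, which is (i). For (ii), \<open>f x = 2 x + 2 x / (x - 1)\<close> is
  increasing for \<open>x \<ge> 2\<close> with minimum \<open>f 2 = 8\<close>, and \<open>D \<le> 2 R\<close>; for \<open>D < 2\<close> the crude bound
  \<open>p < 4 D < 8\<close> suffices.

  Scott's inequality comes from comparing areas: the area is at least \<open>D w / 2\<close>, while a
  lattice-free body with all widths above \<open>w > 1\<close> has area at most \<open>w\<^sup>2 / (2 (w - 1))\<close>.
  The rectangles \<open>[0, N] \<times> [0, 1]\<close> show that the constant 2 is optimal.\<close>

section \<open>Total variation along the boundary of a convex body\<close>

definition perp :: "real^2 \<Rightarrow> real^2" where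
  "perp n = vector [- n$2, n$1]"

lemma perp_nth [simp]: "perp n $ 1 = - n$2" "perp n $ 2 = n$1"
  by (simp_all add: perp_def)

lemma inner_real2: "x \<bullet> y = x$1 * y$1 + x$2 * y$2" for x y :: "real^2"
  by (simp add: inner_vec_def sum_2)

lemma real2_eq_iff: "x = y \<longleftrightarrow> x$1 = y$1 \<and> x$2 = y$2" for x y :: "real^2"
  by (simp add: vec_eq_iff forall_2)

lemma norm_real2: "(norm x)\<^sup>2 = (x$1)\<^sup>2 + (x$2)\<^sup>2" for x :: "real^2"
  using dot_square_norm[of x] by (simp add: inner_real2 power2_eq_square)

lemma norm_perp [simp]: "norm (perp n) = norm n"
  by (simp add: norm_eq_sqrt_inner inner_real2 algebra_simps)

lemma perp_eq_0_iff [simp]: "perp n = 0 \<longleftrightarrow> n = 0"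
  by (auto simp: real2_eq_iff)

text \<open>Lagrange's identity, or Pythagoras in the orthogonal frame \<open>n\<close>,
  \<open>perp n\<close>.\<close>

lemma norm_inner_perp:
  "(norm n)\<^sup>2 * (norm z)\<^sup>2 = (n \<bullet> z)\<^sup>2 + (perp n \<bullet> z)\<^sup>2"
  by (simp add: norm_real2 inner_real2) (simp add: power2_eq_square algebra_simps)

lemma orthogonal_imp_multiple_perp:
  assumes "n \<noteq> 0" "n \<bullet> z = 0"
  shows "\<exists>s. z = s *\<^sub>R perp n"
proof -
  have d: "(n$1)\<^sup>2 + (n$2)\<^sup>2 \<noteq> 0"
    using assms(1) by (metis norm_real2 norm_eq_zero power_eq_0_iff)
  have o: "n$1 * z$1 = - (n$2 * z$2)" using assms(2) by (simp add: inner_real2)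
  \<comment> \<open>The coefficient on the right is \<open>perp n \<bullet> z\<close>.\<close>
  have "((n$1)\<^sup>2 + (n$2)\<^sup>2) *\<^sub>R z = (z$2 * n$1 - z$1 * n$2) *\<^sub>R perp n"
    unfolding real2_eq_iff using o by (simp, algebra)
  then have "z = ((z$2 * n$1 - z$1 * n$2) / ((n$1)\<^sup>2 + (n$2)\<^sup>2)) *\<^sub>R perp n"
    using d by (metis (no_types) divide_inverse mult.commute scaleR_scaleR scaleR_one left_inverse)
  then show ?thesis by blast
qed

text \<open>The points \<open>x\<close> and \<open>y\<close> force the line through an interior
  point \<open>i\<close>. On a ray from \<open>i\<close>, everything before a frontier point is
  interior, so each of the two rays of the line carries at most one frontier point.\<close>

lemma no_three_frontier_points_on_line:
  fixes K :: "(real^2) set"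
  assumes K: "convex K" "closed K" "interior K \<noteq> {}"
    and x: "x \<in> K" "n \<bullet> x < c" and y: "y \<in> K" "c < n \<bullet> y"
    and F: "A \<in> frontier K" "B \<in> frontier K" "C \<in> frontier K"
    and L: "n \<bullet> A = c" "n \<bullet> B = c" "n \<bullet> C = c"
    and D: "A \<noteq> B" "A \<noteq> C" "B \<noteq> C"
  shows False
proof -
  have n: "n \<noteq> 0" using x(2) y(2) by auto
  \<comment> \<open>Density moves \<open>x\<close> and \<open>y\<close> into the interior, whose
    connectedness then yields \<open>i\<close>.\<close>
  have cl: "K \<subseteq> closure (interior K)"
    using K convex_closure_interior closure_subset by blast
  have "open {z. n \<bullet> z < c}" "open {z. n \<bullet> z > c}"
    by (auto intro: open_halfspace_lt open_halfspace_gt)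
  then have "{z. n \<bullet> z < c} \<inter> interior K \<noteq> {}" "{z. n \<bullet> z > c} \<inter> interior K \<noteq> {}"
    using cl x y open_Int_closure_eq_empty by blast+
  then obtain x' y' where "x' \<in> interior K" "n \<bullet> x' < c" "y' \<in> interior K" "c < n \<bullet> y'"
    by blast
  then obtain i where i: "i \<in> interior K" "n \<bullet> i = c"
    using connected_ivt_hyperplane[of "interior K" x' y' n c] K(1)
    by (meson convex_connected convex_interior less_imp_le)
  have par: "\<exists>s. s \<noteq> 0 \<and> X = i + s *\<^sub>R perp n" if "X \<in> frontier K" "n \<bullet> X = c" for X
  proof -
    have "n \<bullet> (X - i) = 0" using that i by (simp add: inner_diff_right)
    then obtain s where "X - i = s *\<^sub>R perp n"
      using orthogonal_imp_multiple_perp n by blast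
    moreover have "X \<noteq> i" using that i by (auto simp: frontier_def)
    ultimately show ?thesis by (metis add_diff_cancel_left' diff_add_cancel add.commute scale_zero_left diff_eq_eq add_0)
  qed
  have key: False if XY: "i + s *\<^sub>R perp n \<in> frontier K" "i + t *\<^sub>R perp n \<in> frontier K"
    and st: "0 < s / t" "s / t < 1" for s t
  proof -
    have "i + s *\<^sub>R perp n \<in> open_segment i (i + t *\<^sub>R perp n)"
      using st n unfolding in_segment
      by (intro conjI exI[of _ "s/t"]) (auto simp: algebra_simps)
    moreover have "i + t *\<^sub>R perp n \<in> closure K"
      using XY(2) by (simp add: frontier_def)
    ultimately have "i + s *\<^sub>R perp n \<in> interior K"
      using in_interior_closure_convex_segment[OF K(1) i(1)] by blast
    then show False using XY(1) by (simp add: frontier_def)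
  qed
  have key2: "s * t < 0" if XY: "i + s *\<^sub>R perp n \<in> frontier K" "i + t *\<^sub>R perp n \<in> frontier K"
    and st: "s \<noteq> t" "s \<noteq> 0" "t \<noteq> 0" for s t
  proof (rule ccontr)
    assume "\<not> s * t < 0"
    then have "0 < s * t" using st by (simp add: less_eq_real_def not_less)
    then have "0 < s / t" "0 < t / s" by (auto simp: zero_less_mult_iff zero_less_divide_iff)
    moreover have "s / t < 1 \<or> t / s < 1"
      using st \<open>0 < s * t\<close> by (auto simp: divide_less_eq zero_less_mult_iff)
    ultimately show False using key XY by blast
  qed
  obtain a b d where abd: "a \<noteq> 0" "A = i + a *\<^sub>R perp n" "b \<noteq> 0" "B = i + b *\<^sub>R perp n"
    "d \<noteq> 0" "C = i + d *\<^sub>R perp n"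
    using par F L by metis
  have "a \<noteq> b" "a \<noteq> d" "b \<noteq> d" using D abd by auto
  then have "a * b < 0" "a * d < 0" "b * d < 0"
    using key2 abd F by auto
  then show False by (auto simp: mult_less_0_iff)
qed

lemma mono_partition_bounds:
  fixes t :: "nat \<Rightarrow> real"
  assumes "t 0 = 0" "t n = 1" "mono_on {..n} t" "i \<le> n"
  shows "t i \<in> {0..1}"
  using assms mono_onD[OF assms(3), of 0 i] mono_onD[OF assms(3), of i n] by auto

text \<open>The variation is the integral over \<open>c\<close> of the number of steps crossing the line
  \<open>n \<bullet> z = c\<close>, and each crossing uses up one of the at most two frontier points on that line.\<close>

lemma boundary_variation_le:
  fixes K :: "(real^2) set"
  assumes K: "convex K" "compact K" "interior K \<noteq> {}"
    and g: "boundary_parametrization K g"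
    and E: "\<And>x y. x \<in> K \<Longrightarrow> y \<in> K \<Longrightarrow> v \<bullet> (x - y) \<le> E"
    and t: "t 0 = 0" "t n = 1" "mono_on {..n} t"
  shows "(\<Sum>i<n. \<bar>v \<bullet> (g (t (Suc i)) - g (t i))\<bar>) \<le> 2 * E"
proof -
  have cK: "closed K" using K compact_imp_closed by auto
  have sp: "simple_path g" and im: "path_image g = frontier K"
    using g by (auto simp: boundary_parametrization_def)
  have cont: "continuous_on {0..1} g"
    using sp by (simp add: simple_path_def path_def)
  have gF: "g s \<in> frontier K" if "s \<in> {0..1}" for s
    using im that by (auto simp: path_image_def)
  then have gK: "g s \<in> K" if "s \<in> {0..1}" for s
    using that cK frontier_subset_closed by blast
  define h where "h s = v \<bullet> g s" for s
  have conth: "continuous_on {0..1} h"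
    unfolding h_def by (intro continuous_intros cont)
  have tb: "t i \<in> {0..1}" if "i \<le> n" for i
    using mono_partition_bounds[OF t that] .
  have tm: "t i \<le> t j" if "i \<le> j" "j \<le> n" for i j
    using mono_onD[OF t(3), of i j] that by auto
  define m where "m = Inf ((\<bullet>) v ` K)"
  define M where "M = Sup ((\<bullet>) v ` K)"
  have comp: "compact ((\<bullet>) v ` K)" "(\<bullet>) v ` K \<noteq> {}"
    using K interior_subset by (auto intro!: compact_continuous_image continuous_intros)
  then obtain xm xM where xm: "xm \<in> K" "v \<bullet> xm = m" and xM: "xM \<in> K" "v \<bullet> xM = M"
    unfolding m_def M_def
    using closed_contains_Inf[OF comp(2)] closed_contains_Sup[OF comp(2)]
      compact_imp_closed compact_imp_bounded bounded_imp_bdd_above bounded_imp_bdd_below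
    by (metis (no_types, lifting) imageE)
  have "bdd_below ((\<bullet>) v ` K)" "bdd_above ((\<bullet>) v ` K)"
    using comp(1) by (auto intro: compact_imp_bounded bounded_imp_bdd_above bounded_imp_bdd_below)
  then have mM: "m \<le> v \<bullet> x" "v \<bullet> x \<le> M" if "x \<in> K" for x
    unfolding m_def M_def using that by (auto intro: cInf_lower cSup_upper)
  have ME: "M - m \<le> E" using E[OF xM(1) xm(1)] xm xM by (simp add: inner_diff_right)
  \<comment> \<open>Open intervals place each crossing parameter strictly inside its step. Different
    steps then have different crossing parameters, none of them 0 or 1, the one pair that
    \<open>g\<close> identifies. They also keep \<open>c\<close> strictly between \<open>m\<close>
    and \<open>M\<close>.\<close>
  define I where "I i = {min (h (t i)) (h (t (Suc i))) <..< max (h (t i)) (h (t (Suc i)))}" for i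
  have hb: "m \<le> h s" "h s \<le> M" if "s \<in> {0..1}" for s
    using mM gK that by (auto simp: h_def)
  have card: "card {i. i < n \<and> c \<in> I i} \<le> 2" for c
  proof (rule ccontr)
    assume "\<not> card {i. i < n \<and> c \<in> I i} \<le> 2"
    then have "3 \<le> card {i. i < n \<and> c \<in> I i}" by simp
    then obtain T where T: "T \<subseteq> {i. i < n \<and> c \<in> I i}" "card T = 3"
      using obtain_subset_with_card_n by metis
    have "\<exists>s. t i < s \<and> s < t (Suc i) \<and> h s = c" if "i \<in> T" for i
    proof -
      have i: "i < n" "c \<in> I i" using that T by auto
      have le: "t i \<le> t (Suc i)" using tm i by auto
      have sub: "{t i..t (Suc i)} \<subseteq> {0..1}" using tb[of i] tb[of "Suc i"] i by auto
      have c: "continuous_on {t i..t (Suc i)} h" using conth sub continuous_on_subset by blast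
      have "\<exists>s. t i \<le> s \<and> s \<le> t (Suc i) \<and> h s = c"
        using IVT'[of h "t i" c "t (Suc i)", OF _ _ le c] IVT2'[of h "t (Suc i)" c "t i", OF _ _ le c] i(2)
        unfolding I_def by (auto simp: min_def max_def split: if_splits)
      then obtain s where s: "t i \<le> s" "s \<le> t (Suc i)" "h s = c" by auto
      then have "s \<noteq> t i" "s \<noteq> t (Suc i)" using i(2) unfolding I_def by auto
      then show ?thesis using s by (intro exI[of _ s]) auto
    qed
    then obtain s where s: "\<And>i. i \<in> T \<Longrightarrow> t i < s i \<and> s i < t (Suc i) \<and> h (s i) = c"
      by metis
    have s01: "0 < s i" "s i < 1" if "i \<in> T" for i
    proof -
      have "i < n" using that T by auto
      then show "0 < s i" "s i < 1" using s[OF that] tb[of i] tb[of "Suc i"] by auto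
    qed
    have lt: "s i < s j" if "i \<in> T" "j \<in> T" "i < j" for i j
    proof -
      have "t (Suc i) \<le> t j" using tm that T by auto
      then show ?thesis using s[OF that(1)] s[OF that(2)] by linarith
    qed
    have ne: "g (s i) \<noteq> g (s j)" if "i \<in> T" "j \<in> T" "i \<noteq> j" for i j
    proof
      assume eq: "g (s i) = g (s j)"
      have "s i \<noteq> s j" using lt that by (metis less_irrefl linorder_neqE)
      moreover have "s i \<in> {0..1}" "s j \<in> {0..1}" using s01 that by (auto intro: less_imp_le)
      ultimately have "s i = 0 \<or> s j = 0" using sp eq unfolding simple_path_def loop_free_def by blast
      then show False using s01 that by force
    qed
    obtain i j k where ijk: "T = {i,j,k}" "i \<noteq> j" "i \<noteq> k" "j \<noteq> k"
      using T(2) by (auto simp: card_3_iff)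
    have i: "i < n" "c \<in> I i" using T ijk by auto
    have mM': "m < c" "c < M"
      using i(2) hb[OF tb[of i]] hb[OF tb[of "Suc i"]] i(1) unfolding I_def by auto
    have fr: "g (s l) \<in> frontier K" if "l \<in> T" for l
      using gF s01[OF that] by (simp add: less_imp_le)
    have on: "v \<bullet> g (s l) = c" if "l \<in> T" for l
      using s[OF that] by (simp add: h_def)
    show False
      by (rule no_three_frontier_points_on_line[OF K(1) cK K(3) xm(1) _ xM(1),
            where A="g (s i)" and B="g (s j)" and C="g (s k)" and n=v and c=c])
         (use ijk mM' xm xM fr on ne in auto)
  qed
  \<comment> \<open>Each step length is the Lebesgue measure of \<open>I i\<close>. Exchanging sum
    and integral leaves the number of crossings, at most 2 on \<open>{m..M}\<close> and 0
    elsewhere.\<close>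
  have "ennreal (\<Sum>i<n. \<bar>h (t (Suc i)) - h (t i)\<bar>) = (\<Sum>i<n. emeasure lborel (I i))"
    by (subst sum_ennreal[symmetric], simp, rule sum.cong)
       (auto simp: I_def min_def max_def abs_if)
  also have "\<dots> = (\<Sum>i<n. \<integral>\<^sup>+c. indicator (I i) c \<partial>lborel)"
    by (intro sum.cong nn_integral_indicator[symmetric]) (auto simp: I_def)
  also have "\<dots> = (\<integral>\<^sup>+c. (\<Sum>i<n. indicator (I i) c) \<partial>lborel)"
    by (intro nn_integral_sum[symmetric]) (auto simp: I_def)
  also have "\<dots> \<le> (\<integral>\<^sup>+c. 2 * indicator {m..M} c \<partial>lborel)"
  proof (rule nn_integral_mono)
    fix c :: real
    have eq: "(\<Sum>i<n. indicator (I i) c :: ennreal) = of_nat (card {i. i < n \<and> c \<in> I i})"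
      by (simp add: indicator_def sum.If_cases Int_def)
    show "(\<Sum>i<n. indicator (I i) c :: ennreal) \<le> 2 * indicator {m..M} c"
    proof (cases "c \<in> {m..M}")
      case True
      have "(of_nat (card {i. i < n \<and> c \<in> I i}) :: ennreal) \<le> of_nat 2"
        using card[of c] by (simp only: of_nat_le_iff)
      with True show ?thesis by (simp add: eq)
    next
      case False
      have "{i. i < n \<and> c \<in> I i} = {}"
      proof -
        have "c \<in> {m..M}" if "i < n" "c \<in> I i" for i
          using that(2) hb[OF tb[of i]] hb[OF tb[of "Suc i"]] that(1) unfolding I_def by auto
        then show ?thesis using False by auto
      qed
      then show ?thesis by (simp only: eq card.empty) simp
    qed
  qed
  also have "\<dots> = 2 * ennreal (M - m)"
    using mM[OF xm(1)] by (simp add: nn_integral_cmult)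
  also have "\<dots> = ennreal (2 * (M - m))"
    using mM[OF xm(1)] by (subst ennreal_mult) auto
  finally have "(\<Sum>i<n. \<bar>h (t (Suc i)) - h (t i)\<bar>) \<le> 2 * (M - m)"
    using mM[OF xm(1)] xm by (subst (asm) ennreal_le_iff) auto
  then show ?thesis using ME by (simp add: h_def inner_diff_right)
qed

section \<open>Perimeter, diameter and width\<close>

text \<open>A refinement of \<open>norm z \<le> \<bar>u\<bar> + \<bar>v\<bar>\<close> for the coordinates \<open>u\<close>, \<open>v\<close> of \<open>z\<close>: the correction is
  \<open>- \<delta> * min (a * \<bar>u\<bar>) (b * \<bar>v\<bar>)\<close>, written in terms of the variation along the diagonals of an
  \<open>a \<times> b\<close> rectangle. It makes the perimeter bound strict.\<close>

lemma norm_le_weighted_inner: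
  fixes n z :: "real^2"
  assumes n: "norm n = 1" and ab: "a > 0" "b > 0"
  defines "\<delta> \<equiv> 1 / (2 * (a + b))"
  shows "norm z \<le> (1 - \<delta> * a) * \<bar>perp n \<bullet> z\<bar> + (1 - \<delta> * b) * \<bar>n \<bullet> z\<bar>
    + \<delta> / 2 * (\<bar>(a *\<^sub>R perp n + b *\<^sub>R n) \<bullet> z\<bar> + \<bar>(a *\<^sub>R perp n - b *\<^sub>R n) \<bullet> z\<bar>)"
proof -
  define u v where "u = \<bar>perp n \<bullet> z\<bar>" and "v = \<bar>n \<bullet> z\<bar>"
  have uv: "0 \<le> u" "0 \<le> v" by (auto simp: u_def v_def)
  have nz: "(norm z)\<^sup>2 = u\<^sup>2 + v\<^sup>2"
    using norm_inner_perp[of n z] n by (simp add: u_def v_def)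
  \<comment> \<open>\<open>u + v - r\<close> is the larger coordinate plus half the smaller one. It
    bounds \<open>sqrt (u\<^sup>2 + v\<^sup>2)\<close> because the product of the coordinates is at
    least the square of the smaller.\<close>
  define r where "r = min u v / 2"
  have "(norm z)\<^sup>2 \<le> (u + v - r)\<^sup>2"
  proof (cases "u \<le> v")
    case True
    have "u * u \<le> u * v" using True uv by (intro mult_left_mono) auto
    moreover have "0 \<le> u * v" using uv by simp
    moreover have "(v + u / 2)\<^sup>2 = v * v + u * v + u * u / 4"
      by (simp add: power2_eq_square field_simps)
    ultimately have "u\<^sup>2 + v\<^sup>2 \<le> (v + u / 2)\<^sup>2" unfolding power2_eq_square by linarith
    then show ?thesis using True nz by (simp add: r_def field_simps)
  next
    case False
    have "v * v \<le> u * v" using False uv by (intro mult_right_mono) auto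
    moreover have "0 \<le> u * v" using uv by simp
    moreover have "(u + v / 2)\<^sup>2 = u * u + u * v + v * v / 4"
      by (simp add: power2_eq_square field_simps)
    ultimately have "u\<^sup>2 + v\<^sup>2 \<le> (u + v / 2)\<^sup>2" unfolding power2_eq_square by linarith
    then show ?thesis using False nz by (simp add: r_def min_def field_simps)
  qed
  then have 1: "norm z \<le> u + v - r"
    using uv by (rule_tac power2_le_imp_le) (auto simp: r_def min_def)
  \<comment> \<open>The size of \<open>\<delta>\<close> enters here: \<open>\<delta> * a\<close> and
    \<open>\<delta> * b\<close> are at most one half.\<close>
  have "\<delta> * (a * u) \<le> u / 2" "\<delta> * (b * v) \<le> v / 2"
    using ab uv unfolding \<delta>_def by (auto simp: field_simps)
  then have 2: "\<delta> * min (a * u) (b * v) \<le> r"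
    using ab unfolding r_def min_def by (smt (verit) \<delta>_def divide_pos_pos mult_left_mono)
  \<comment> \<open>The subtracted term is the maximum, since \<open>max \<bar>p\<bar> \<bar>q\<bar>
    = (\<bar>p + q\<bar> + \<bar>p - q\<bar>) / 2\<close>.\<close>
  have 3: "min (a * u) (b * v) = a * u + b * v
      - (\<bar>a * (perp n \<bullet> z) + b * (n \<bullet> z)\<bar> + \<bar>a * (perp n \<bullet> z) - b * (n \<bullet> z)\<bar>) / 2"
  proof -
    have "a * u = \<bar>a * (perp n \<bullet> z)\<bar>" "b * v = \<bar>b * (n \<bullet> z)\<bar>"
      using ab by (auto simp: u_def v_def abs_mult)
    then show ?thesis by (auto simp: min_def abs_if field_simps)
  qed
  have "norm z \<le> u + v - \<delta> * min (a * u) (b * v)" using 1 2 by linarith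
  then show ?thesis unfolding 3
    unfolding u_def v_def inner_add_left inner_diff_left inner_scaleR_left
    by (simp add: algebra_simps add_divide_distrib)
qed

text \<open>A \<open>D\<close> by \<open>b\<close> rectangle has boundary variation
  \<open>2 * (D\<^sup>2 + b\<^sup>2)\<close> along each of its diagonal vectors, but the diameter of
  \<open>K\<close> allows only \<open>2 * D * sqrt (D\<^sup>2 + b\<^sup>2)\<close>. The weighted
  norm estimate, summed over the steps, turns this deficit into a saving below
  \<open>2 * D + 2 * b\<close>.\<close>

lemma inscribed_length_le:
  fixes K :: "(real^2) set"
  assumes K: "convex K" "compact K" "interior K \<noteq> {}"
    and g: "boundary_parametrization K g"
    and n: "norm n = 1" and b: "b > 0" "\<And>x y. x \<in> K \<Longrightarrow> y \<in> K \<Longrightarrow> n \<bullet> (x - y) \<le> b"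
    and D: "D > 0" "\<And>x y. x \<in> K \<Longrightarrow> y \<in> K \<Longrightarrow> dist x y \<le> D"
    and t: "t 0 = 0" "t N = 1" "mono_on {..N} t"
  defines "\<delta> \<equiv> 1 / (2 * (D + b))"
  shows "(\<Sum>i<N. dist (g (t i)) (g (t (Suc i))))
    \<le> 2 * D + 2 * b - 2 * \<delta> * (D\<^sup>2 + b\<^sup>2 - D * sqrt (D\<^sup>2 + b\<^sup>2))"
proof -
  define S where "S w = (\<Sum>i<N. \<bar>w \<bullet> (g (t (Suc i)) - g (t i))\<bar>)" for w
  have S: "S w \<le> 2 * E" if "\<And>x y. x \<in> K \<Longrightarrow> y \<in> K \<Longrightarrow> w \<bullet> (x - y) \<le> E" for w E
    unfolding S_def by (rule boundary_variation_le[OF K g that t])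
  have SD: "S w \<le> 2 * (norm w * D)" for w
  proof (rule S)
    fix x y assume "x \<in> K" "y \<in> K"
    have "w \<bullet> (x - y) \<le> norm w * norm (x - y)" by (rule norm_cauchy_schwarz)
    also have "\<dots> \<le> norm w * D"
      using D(2)[OF \<open>x \<in> K\<close> \<open>y \<in> K\<close>] by (intro mult_left_mono) (auto simp: dist_norm)
    finally show "w \<bullet> (x - y) \<le> norm w * D" .
  qed
  have o: "perp n \<bullet> n = 0" by (simp add: inner_real2)
  have nn: "n \<bullet> n = 1" "perp n \<bullet> perp n = 1"
    using n by (auto simp: dot_square_norm)
  have "norm (D *\<^sub>R perp n + b *\<^sub>R n) = sqrt (D\<^sup>2 + b\<^sup>2)"
    "norm (D *\<^sub>R perp n - b *\<^sub>R n) = sqrt (D\<^sup>2 + b\<^sup>2)"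
    unfolding norm_eq_sqrt_inner
    by (simp_all add: inner_add inner_diff o nn inner_commute[of n "perp n"] power2_eq_square)
  then have S34: "S (D *\<^sub>R perp n + b *\<^sub>R n) \<le> 2 * (sqrt (D\<^sup>2 + b\<^sup>2) * D)"
     "S (D *\<^sub>R perp n - b *\<^sub>R n) \<le> 2 * (sqrt (D\<^sup>2 + b\<^sup>2) * D)"
    using SD by metis+
  have S1: "S (perp n) \<le> 2 * D" using SD[of "perp n"] n by simp
  have S2: "S n \<le> 2 * b" using S b by blast
  \<comment> \<open>These bounds keep the weights in the sums below nonnegative.\<close>
  have \<delta>: "0 < \<delta>" "\<delta> * D \<le> 1" "\<delta> * b \<le> 1"
    using D(1) b(1) by (auto simp: \<delta>_def field_simps)
  have "(\<Sum>i<N. dist (g (t i)) (g (t (Suc i))))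
    \<le> (\<Sum>i<N. (1 - \<delta> * D) * \<bar>perp n \<bullet> (g (t (Suc i)) - g (t i))\<bar>
        + (1 - \<delta> * b) * \<bar>n \<bullet> (g (t (Suc i)) - g (t i))\<bar>
        + \<delta> / 2 * (\<bar>(D *\<^sub>R perp n + b *\<^sub>R n) \<bullet> (g (t (Suc i)) - g (t i))\<bar>
          + \<bar>(D *\<^sub>R perp n - b *\<^sub>R n) \<bullet> (g (t (Suc i)) - g (t i))\<bar>))"
    unfolding \<delta>_def
    by (rule sum_mono, subst dist_commute, subst dist_norm)
      (rule norm_le_weighted_inner[OF n D(1) b(1)])
  also have "\<dots> = (1 - \<delta> * D) * S (perp n) + (1 - \<delta> * b) * S n
      + \<delta> / 2 * (S (D *\<^sub>R perp n + b *\<^sub>R n) + S (D *\<^sub>R perp n - b *\<^sub>R n))"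
    unfolding S_def by (simp only: sum.distrib sum_distrib_left distrib_left)
  also have "\<dots> \<le> (1 - \<delta> * D) * (2 * D) + (1 - \<delta> * b) * (2 * b)
      + \<delta> / 2 * (2 * (sqrt (D\<^sup>2 + b\<^sup>2) * D) + 2 * (sqrt (D\<^sup>2 + b\<^sup>2) * D))"
    using \<delta> S1 S2 S34 by (intro add_mono mult_left_mono) auto
  also have "\<dots> = 2 * D + 2 * b - 2 * \<delta> * (D\<^sup>2 + b\<^sup>2 - D * sqrt (D\<^sup>2 + b\<^sup>2))"
    by (simp add: algebra_simps power2_eq_square)
  finally show ?thesis .
qed

lemma diameter_pos:
  assumes "bounded K" "x \<in> K" "y \<in> K" "x \<noteq> (y::'a::metric_space)"
  shows "0 < diameter K"
  using diameter_bounded_bound[OF assms(1-3)] assms(4) by (metis less_le_trans zero_less_dist_iff)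

text \<open>The bound \<open>B\<close> on inscribed lengths is the same for all partitions, so
  strictness survives the supremum. It rests on \<open>D < s\<close>, where \<open>s\<close> is the
  diagonal of a \<open>D\<close> by \<open>b\<close> rectangle.\<close>

lemma perimeter_less:
  fixes K :: "(real^2) set"
  assumes K: "convex K" "compact K" "x \<in> K" "y \<in> K" "x \<noteq> y"
    and n: "norm n = 1" and b: "b > 0" "\<And>x y. x \<in> K \<Longrightarrow> y \<in> K \<Longrightarrow> n \<bullet> (x - y) \<le> b"
  shows "perimeter K < 2 * diameter K + 2 * b"
proof (cases "interior K = {}")
  case True
  then show ?thesis using b by (simp add: perimeter_def)
next
  case False
  define g where "g = (SOME g. boundary_parametrization K g)"
  have g: "boundary_parametrization K g"
    unfolding g_def using boundary_parametrization_exists[OF K(2,1) False] by (rule someI_ex)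
  define D where "D = diameter K"
  have bK: "bounded K" using K compact_imp_bounded by auto
  have D: "D > 0" "\<And>x y. x \<in> K \<Longrightarrow> y \<in> K \<Longrightarrow> dist x y \<le> D"
    unfolding D_def using diameter_bounded_bound[OF bK] diameter_pos[OF bK K(3-5)] by auto
  define \<delta> where "\<delta> = 1 / (2 * (D + b))"
  have \<delta>: "\<delta> > 0" using D b by (simp add: \<delta>_def)
  define B where "B = 2 * D + 2 * b - 2 * \<delta> * (D\<^sup>2 + b\<^sup>2 - D * sqrt (D\<^sup>2 + b\<^sup>2))"
  define s where "s = sqrt (D\<^sup>2 + b\<^sup>2)"
  have s: "D < s" "s * s = D\<^sup>2 + b\<^sup>2"
    using D(1) b(1) by (auto simp: s_def real_less_rsqrt)
  have "D * s < s * s" using s D(1) by (intro mult_strict_right_mono) auto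
  then have "B < 2 * D + 2 * b" unfolding B_def using \<delta> s(2) by (simp add: s_def)
  moreover have "perimeter K \<le> B"
  proof -
    have "curve_length g \<le> B" unfolding curve_length_def
    proof (rule cSup_least)
      show "{\<Sum>i<n. dist (g (t i)) (g (t (Suc i))) | (n::nat) (t::nat \<Rightarrow> real).
            t 0 = 0 \<and> t n = 1 \<and> mono_on {..n} t} \<noteq> {}"
        by (auto intro!: exI[of _ "1::nat"] exI[of _ real] simp: mono_on_def)
    next
      fix l assume "l \<in> {\<Sum>i<n. dist (g (t i)) (g (t (Suc i))) | (n::nat) (t::nat \<Rightarrow> real).
            t 0 = 0 \<and> t n = 1 \<and> mono_on {..n} t}"
      then obtain N t where "l = (\<Sum>i<N. dist (g (t i)) (g (t (Suc i))))"
        "t 0 = 0" "t N = 1" "mono_on {..N} t" by auto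
      then show "l \<le> B" unfolding B_def \<delta>_def
        using inscribed_length_le[OF K(1,2) False g n b D, of t N] by simp
    qed
    then show ?thesis using False by (simp add: perimeter_def g_def)
  qed
  ultimately show ?thesis by (simp add: D_def)
qed

text \<open>The tool for bounding perimeters from below. Inscribed lengths are bounded, so the
  supremum dominates each of them; \<open>g\<close> is the curve that \<open>perimeter\<close>
  itself selects.\<close>

lemma inscribed_length_le_perimeter:
  fixes K :: "(real^2) set"
  assumes K: "convex K" "compact K" "interior K \<noteq> {}"
  obtains g where "boundary_parametrization K g"
    "\<And>N t. t 0 = 0 \<Longrightarrow> t N = 1 \<Longrightarrow> mono_on {..N} t \<Longrightarrow>
      (\<Sum>i<N. dist (g (t i)) (g (t (Suc i)))) \<le> perimeter K"
proof -
  define g where "g = (SOME g. boundary_parametrization K g)"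
  have g: "boundary_parametrization K g"
    unfolding g_def using boundary_parametrization_exists[OF K(2,1) K(3)] by (rule someI_ex)
  have bK: "bounded K" using K compact_imp_bounded by auto
  define D where "D = diameter K + 1"
  have D: "D > 0" "\<And>x y. x \<in> K \<Longrightarrow> y \<in> K \<Longrightarrow> dist x y \<le> D"
    unfolding D_def using diameter_bounded_bound[OF bK] diameter_ge_0[OF bK] by (auto intro: add_increasing2)
  define n :: "real^2" where "n = axis 1 1"
  have n: "norm n = 1" by (simp add: n_def)
  have b: "n \<bullet> (x - y) \<le> D" if "x \<in> K" "y \<in> K" for x y
    using norm_cauchy_schwarz[of n "x - y"] D(2)[OF that] n by (simp add: dist_norm)
  have "(\<Sum>i<N. dist (g (t i)) (g (t (Suc i)))) \<le> perimeter K"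
    if "t 0 = 0" "t N = 1" "mono_on {..N} t" for N t
  proof -
    have "(\<Sum>i<N. dist (g (t i)) (g (t (Suc i)))) \<le> curve_length g"
      unfolding curve_length_def
    proof (rule cSup_upper)
      show "bdd_above {\<Sum>i<n. dist (g (t i)) (g (t (Suc i))) | (n::nat) (t::nat \<Rightarrow> real).
            t 0 = 0 \<and> t n = 1 \<and> mono_on {..n} t}"
        using inscribed_length_le[OF K g n D(1) b D]
        by (intro bdd_aboveI) blast
    qed (use that in blast)
    then show ?thesis using K by (simp add: perimeter_def g_def)
  qed
  with g that show ?thesis by blast
qed

lemma perimeter_nonneg:
  fixes K :: "(real^2) set"
  assumes K: "convex K" "compact K"
  shows "0 \<le> perimeter K"
proof (cases "interior K = {}")
  case True
  then show ?thesis using diameter_ge_0[of K] K compact_imp_bounded by (auto simp: perimeter_def)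
next
  case False
  then obtain g :: "real \<Rightarrow> real^2" where "\<And>N t. t 0 = 0 \<Longrightarrow> t N = 1 \<Longrightarrow> mono_on {..N} t \<Longrightarrow>
      (\<Sum>i<N. dist (g (t i)) (g (t (Suc i)))) \<le> perimeter K"
    using inscribed_length_le_perimeter[OF K] by metis
  from this[of real 1] have "dist (g 0) (g 1) \<le> perimeter K"
    by (simp add: mono_on_def)
  then show ?thesis using zero_le_dist order_trans by blast
qed

section \<open>Area of lattice-free sets\<close>

definition pt :: "real \<Rightarrow> real \<Rightarrow> real^2" where
  "pt x y = x *\<^sub>R axis 1 1 + y *\<^sub>R axis 2 1"

lemma pt_nth [simp]: "pt x y $ 1 = x" "pt x y $ 2 = y"
  by (simp_all add: pt_def axis_def)

lemma pt_eta: "z = pt (z$1) (z$2)"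
  by (simp add: vec_eq_iff forall_2)

lemma pt_arith: "u *\<^sub>R pt x y = pt (u * x) (u * y)" "pt x y + pt x' y' = pt (x + x') (y + y')"
  "pt x y - pt x' y' = pt (x - x') (y - y')"
  by (simp_all add: vec_eq_iff forall_2)

lemma continuous_on_pt [continuous_intros]:
  "continuous_on S f \<Longrightarrow> continuous_on S g \<Longrightarrow> continuous_on S (\<lambda>x. pt (f x) (g x))"
  unfolding pt_def by (intro continuous_intros)

lemma Basis_real2: "(Basis :: (real^2) set) = {axis 1 1, axis 2 1}"
  by (auto simp: Basis_vec_def UNIV_2)

text \<open>Carries plane Lebesgue measure over to \<open>real \<times> real\<close>, where
  Tonelli's theorem applies; comparing the two measures on boxes is enough.\<close>

lemma lborel_real2: "(lborel :: (real^2) measure) = distr lborel borel (\<lambda>(x, y). pt x y)"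
proof (rule lborel_eqI)
  have m: "(\<lambda>(x, y). pt x y) \<in> borel_measurable borel"
    unfolding case_prod_unfold by (intro borel_measurable_continuous_onI continuous_intros)
  fix l u :: "real^2" assume le: "\<And>b. b \<in> Basis \<Longrightarrow> l \<bullet> b \<le> u \<bullet> b"
  have le': "l$1 \<le> u$1" "l$2 \<le> u$2"
    using le[of "axis 1 1"] le[of "axis 2 1"] by (auto simp: Basis_real2 inner_axis)
  have ne: "axis 1 1 \<noteq> (axis 2 1 :: real^2)" by (simp add: axis_eq_axis)
  have "emeasure (distr lborel borel (\<lambda>(x, y). pt x y)) (box l u)
      = emeasure lborel ((\<lambda>(x, y). pt x y) -` box l u)"
    using m by (subst emeasure_distr) auto
  also have "(\<lambda>(x, y). pt x y) -` box l u = {l$1<..<u$1} \<times> {l$2<..<u$2}"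
    by (auto simp: mem_box_cart forall_2)
  also have "emeasure lborel \<dots> = emeasure lborel {l$1<..<u$1} * emeasure lborel {l$2<..<u$2}"
    by (subst lborel_prod[symmetric]) (simp add: lborel.emeasure_pair_measure_Times)
  also have "\<dots> = (\<Prod>b\<in>Basis. (u - l) \<bullet> b)"
    using le' ne by (simp add: Basis_real2 inner_axis ennreal_mult)
  finally show "emeasure (distr lborel borel (\<lambda>(x, y). pt x y)) (box l u)
      = (\<Prod>b\<in>Basis. (u - l) \<bullet> b)" .
qed simp

text \<open>\<open>V\<close> is an interval, and every nonnegative number below its length is a
  difference of two of its points. Hence \<open>W\<close> contains a half-open interval of that
  length.\<close>

lemma emeasure_le_differences:
  fixes V W :: "real set"
  assumes V: "convex V" "bounded V" and W: "W \<in> sets lborel"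
    and D: "\<And>x s. 0 \<le> s \<Longrightarrow> x \<in> V \<Longrightarrow> x + s \<in> V \<Longrightarrow> s \<in> W"
  shows "emeasure lborel V \<le> emeasure lborel W"
proof (cases "V = {}")
  case False
  define a b where "a = Inf V" and "b = Sup V"
  have bd: "bdd_above V" "bdd_below V"
    using V by (auto intro: bounded_imp_bdd_above bounded_imp_bdd_below)
  have sub: "V \<subseteq> {a..b}"
    unfolding a_def b_def using bd by (auto intro: cInf_lower cSup_upper)
  then have ab: "a \<le> b" using False by fastforce
  have "{0..<b - a} \<subseteq> W"
  proof
    fix s assume s: "s \<in> {0..<b - a}"
    \<comment> \<open>With half the slack spent at each end, points within \<open>e\<close> of the
      two ends are still more than \<open>s\<close> apart.\<close>
    define e where "e = (b - a - s) / 2"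
    have e: "e > 0" using s by (simp add: e_def)
    obtain x where x: "x \<in> V" "x < a + e"
      using cInf_lessD[OF False, of "a + e"] e unfolding a_def by auto
    obtain y where y: "y \<in> V" "b - e < y"
      using less_cSupD[OF False, of "b - e"] e unfolding b_def by auto
    have "x + s \<le> y" using x y by (simp add: e_def field_simps)
    moreover have "is_interval V" using V by (simp add: is_interval_convex_1)
    ultimately have "x + s \<in> V"
      using x y s unfolding is_interval_1 by (metis atLeastLessThan_iff le_add_same_cancel1)
    then show "s \<in> W" using D x s by auto
  qed
  then have "emeasure lborel {0..<b - a} \<le> emeasure lborel W"
    using W by (intro emeasure_mono) auto
  moreover have "emeasure lborel V \<le> emeasure lborel {a..b}"
    using sub by (intro emeasure_mono) auto
  ultimately show ?thesis using ab by simp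
qed simp

lemma emeasure_lborel_slices:
  fixes A :: "(real \<times> real) set"
  assumes "A \<in> sets borel"
  shows "emeasure lborel A = (\<integral>\<^sup>+x. emeasure lborel (Pair x -` A) \<partial>lborel)"
    and "emeasure lborel A = (\<integral>\<^sup>+y. emeasure lborel ((\<lambda>x. (x, y)) -` A) \<partial>lborel)"
proof -
  have A: "A \<in> sets (lborel \<Otimes>\<^sub>M lborel)"
    using assms by (simp only: lborel_prod sets_lborel)
  show "emeasure lborel A = (\<integral>\<^sup>+x. emeasure lborel (Pair x -` A) \<partial>lborel)"
    using lborel.emeasure_pair_measure_alt[OF A] unfolding lborel_prod .
  show "emeasure lborel A = (\<integral>\<^sup>+y. emeasure lborel ((\<lambda>x. (x, y)) -` A) \<partial>lborel)"
    using lborel_pair.emeasure_pair_measure_alt2[OF A] unfolding lborel_prod .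
qed

text \<open>Cavalieri's principle: at each height \<open>y\<close>, the slice of \<open>T\<close>
  contains all differences of points in the slice of \<open>U\<close>, hence is at least as
  long.\<close>

lemma emeasure_le_chords:
  fixes U :: "(real^2) set" and T :: "(real \<times> real) set"
  assumes U: "open U" "convex U" "bounded U" and T: "T \<in> sets borel"
    and C: "\<And>x s y. 0 \<le> s \<Longrightarrow> pt x y \<in> U \<Longrightarrow> pt (x + s) y \<in> U \<Longrightarrow> (s, y) \<in> T"
  shows "emeasure lborel U \<le> emeasure lborel T"
proof -
  have m: "(\<lambda>(x, y). pt x y) \<in> borel_measurable borel"
    unfolding case_prod_unfold by (intro borel_measurable_continuous_onI continuous_intros)
  define V where "V = (\<lambda>(x, y). pt x y) -` U"
  have V: "V \<in> sets borel"
    using measurable_sets[OF m, of U] U by (simp add: V_def)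
  have "emeasure lborel U = emeasure lborel V"
    using m U by (subst lborel_real2, subst emeasure_distr) (auto simp: V_def)
  also have "\<dots> = (\<integral>\<^sup>+y. emeasure lborel ((\<lambda>x. (x, y)) -` V) \<partial>lborel)"
    by (rule emeasure_lborel_slices(2)[OF V])
  also have "\<dots> \<le> (\<integral>\<^sup>+y. emeasure lborel ((\<lambda>s. (s, y)) -` T) \<partial>lborel)"
  proof (intro nn_integral_mono emeasure_le_differences)
    fix y
    have eq: "(\<lambda>x. (x, y)) -` V = {x. pt x y \<in> U}" by (auto simp: V_def)
    show "convex ((\<lambda>x. (x, y)) -` V)"
      unfolding eq
    proof (rule convexI, clarify)
      fix a b u v assume ab: "pt a y \<in> U" "pt b y \<in> U" and uv: "0 \<le> u" "0 \<le> v" "u + v = (1::real)"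
      have "u *\<^sub>R pt a y + v *\<^sub>R pt b y \<in> U" using U ab uv by (auto intro: convexD)
      also have "u *\<^sub>R pt a y + v *\<^sub>R pt b y = pt (u * a + v * b) y"
        using uv by (simp add: pt_arith flip: distrib_right)
      finally show "pt (u *\<^sub>R a + v *\<^sub>R b) y \<in> U" by simp
    qed
    obtain B where B: "\<And>x. x \<in> U \<Longrightarrow> norm x \<le> B" using U bounded_iff by blast
    have "norm x \<le> B" if "pt x y \<in> U" for x
      using B[OF that] component_le_norm_cart[of "pt x y" 1] by simp
    then show "bounded ((\<lambda>x. (x, y)) -` V)" unfolding eq bounded_iff by blast
    show "(\<lambda>s. (s, y)) -` T \<in> sets lborel"
      using T measurable_sets[of "\<lambda>s. (s, y)" borel borel T]
      by (simp add: borel_measurable_continuous_onI continuous_intros)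
    show "s \<in> (\<lambda>s. (s, y)) -` T"
      if "0 \<le> s" "x \<in> (\<lambda>x. (x, y)) -` V" "x + s \<in> (\<lambda>x. (x, y)) -` V" for x s
      using that C unfolding eq by auto
  qed
  also have "\<dots> = emeasure lborel T"
    by (rule emeasure_lborel_slices(2)[OF T, symmetric])
  finally show ?thesis .
qed

text \<open>With \<open>m = p + q\<close>, the vertical slice has length
  \<open>1 + m - m * s\<close>. It shrinks from \<open>1 + m\<close> at \<open>s = 0\<close> to 0 at
  \<open>s = 1 + 1/m\<close>, and at \<open>s = 1\<close> it is \<open>{k..k + 1}\<close>.\<close>

lemma emeasure_triangle:
  fixes p q k :: real
  assumes pq: "0 \<le> p" "0 \<le> q" "0 < p + q"
  defines "T \<equiv> {(s, y). 0 \<le> s \<and> p * (s - 1) \<le> y - k \<and> q * (s - 1) \<le> k + 1 - y}"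
  shows "T \<in> sets borel" "emeasure lborel T = ennreal ((1 + (p + q))\<^sup>2 / (2 * (p + q)))"
proof -
  define m where "m = p + q"
  have m: "m > 0" using pq by (simp add: m_def)
  have "T = {z. 0 \<le> fst z} \<inter> {z. p * (fst z - 1) \<le> snd z - k}
      \<inter> {z. q * (fst z - 1) \<le> k + 1 - snd z}"
    unfolding T_def by auto
  moreover have "closed \<dots>"
    by (intro closed_Int closed_Collect_le continuous_intros)
  ultimately show T: "T \<in> sets borel" by simp
  have "emeasure lborel T = (\<integral>\<^sup>+s. emeasure lborel (Pair s -` T) \<partial>lborel)"
    by (rule emeasure_lborel_slices(1)[OF T])
  also have "\<dots> = (\<integral>\<^sup>+s. ennreal (1 + m - m * s) * indicator {0..1 + 1/m} s \<partial>lborel)"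
  proof (intro nn_integral_cong)
    fix s
    show "emeasure lborel (Pair s -` T) = ennreal (1 + m - m * s) * indicator {0..1 + 1/m} s"
    proof (cases "0 \<le> s")
      case True
      then have eq: "Pair s -` T = {k + p * (s - 1)..k + 1 - q * (s - 1)}"
        by (auto simp: T_def)
      have d: "(k + 1 - q * (s - 1)) - (k + p * (s - 1)) = 1 + m - m * s"
        by (simp add: m_def algebra_simps)
      have iff: "s \<le> 1 + 1/m \<longleftrightarrow> 0 \<le> 1 + m - m * s" using m by (simp add: field_simps)
      show ?thesis
      proof (cases "0 \<le> 1 + m - m * s")
        case 1: True
        then show ?thesis unfolding eq using True d iff by simp
      next
        case False
        then show ?thesis unfolding eq using d iff by (simp del: atLeastatMost_empty_iff)
      qed
    next
      case False
      then have "Pair s -` T = {}" by (auto simp: T_def)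
      then show ?thesis using False by simp
    qed
  qed
  also have "\<dots> = ennreal ((1 + m)\<^sup>2 / (2 * m))"
  proof (rule nn_integral_has_integral_lebesgue')
    show "0 \<le> 1 + m - m * s" if "s \<in> {0..1 + 1/m}" for s
      using that m by (simp add: field_simps)
    have "((\<lambda>s. 1 + m - m * s) has_integral
        ((1 + m) * (1 + 1/m) - m * (1 + 1/m)\<^sup>2 / 2) - ((1 + m) * 0 - m * 0\<^sup>2 / 2)) {0..1 + 1/m}"
      using m by (intro fundamental_theorem_of_calculus)
        (auto intro!: derivative_eq_intros simp flip: has_real_derivative_iff_has_vector_derivative)
    moreover have "((1 + m) * (1 + 1/m) - m * (1 + 1/m)\<^sup>2 / 2) - ((1 + m) * 0 - m * 0\<^sup>2 / 2)
        = (1 + m)\<^sup>2 / (2 * m)"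
      using m by (simp add: field_simps power2_eq_square)
    ultimately show "((\<lambda>s. 1 + m - m * s) has_integral (1 + m)\<^sup>2 / (2 * m)) {0..1 + 1/m}"
      by simp
  qed
  finally show "emeasure lborel T = ennreal ((1 + (p + q))\<^sup>2 / (2 * (p + q)))"
    by (simp add: m_def)
qed

text \<open>\<open>H\<close> misses the horizontal ray at height \<open>k\<close> to the right of
  \<open>(1, k)\<close>, so a line separates the two, and it may be shifted to pass through
  \<open>(1, k)\<close>. The point \<open>(s0, y0)\<close> beyond and above \<open>(1, k)\<close>
  prevents this line from being vertical, so it has a slope \<open>p\<close>.\<close>

lemma supporting_slope:
  fixes H :: "(real \<times> real) set"
  assumes H: "convex H" "(s0, y0) \<in> H" "1 < s0" "k < y0" and k: "\<And>s. (s, k) \<in> H \<Longrightarrow> s \<le> 1"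
  obtains p where "0 \<le> p" "\<And>s y. (s, y) \<in> H \<Longrightarrow> p * (s - 1) \<le> y - k"
proof -
  define R :: "(real \<times> real) set" where "R = {1<..} \<times> {k}"
  have "\<exists>a c. a \<noteq> 0 \<and> (\<forall>z\<in>H. a \<bullet> z \<le> c) \<and> (\<forall>z\<in>R. c \<le> a \<bullet> z)"
    by (rule separating_hyperplane_sets)
      (use H k in \<open>auto simp: R_def intro!: convex_Times convex_real_interval\<close>, force+)
  then obtain a b c where ne: "(a, b) \<noteq> 0" and Hc: "\<And>s y. (s, y) \<in> H \<Longrightarrow> a * s + b * y \<le> c"
    and Rc: "\<And>t. 1 < t \<Longrightarrow> c \<le> a * t + b * k"
    by (force simp: R_def)
  \<comment> \<open>The limit of \<open>Rc\<close> as \<open>t\<close> tends to 1; the next claim is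
    its behaviour for large \<open>t\<close>.\<close>
  have a1: "c \<le> a + b * k"
  proof (rule ccontr)
    assume lt: "\<not> ?thesis"
    define e where "e = (c - a - b * k) / (2 * (\<bar>a\<bar> + 1))"
    have e: "e > 0" using lt by (simp add: e_def)
    have "a * e \<le> (\<bar>a\<bar> + 1) * e" using e by (intro mult_right_mono) auto
    also have "\<dots> = (c - a - b * k) / 2" by (simp add: e_def field_simps add_nonneg_eq_0_iff)
    finally have "a * (1 + e) + b * k < c"
      using lt by (simp add: algebra_simps field_simps)
    then show False using Rc[of "1 + e"] e by simp
  qed
  have a0: "0 \<le> a"
  proof (rule ccontr)
    assume a: "\<not> 0 \<le> a"
    define t where "t = max 2 ((b * k - c) / (- a) + 1)"
    have "t > 1" "t > (b * k - c) / (- a)" by (auto simp: t_def)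
    then have "a * t + b * k < c" using a by (simp add: field_simps)
    then show False using Rc[of t] \<open>t > 1\<close> by simp
  qed
  have main: "a * (s - 1) \<le> - b * (y - k)" if "(s, y) \<in> H" for s y
    using Hc[OF that] a1 by (simp add: algebra_simps)
  have "a * (s0 - 1) \<le> - b * (y0 - k)" using main H by blast
  moreover have "0 \<le> a * (s0 - 1)" using a0 H by simp
  ultimately have b: "b \<le> 0" using H by (smt (verit) mult_pos_pos mult_minus_left)
  moreover have "b \<noteq> 0"
  proof
    assume "b = 0"
    then have "a * (s0 - 1) \<le> 0" using main[OF H(2)] by simp
    then have "a = 0" using a0 H(3) by (simp add: mult_le_0_iff)
    then show False using ne \<open>b = 0\<close> by (simp add: zero_prod_def)
  qed
  ultimately have b: "- b > 0" by simp
  show ?thesis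
  proof
    show "0 \<le> a / (- b)" using a0 b by (intro divide_nonneg_pos)
    show "a / (- b) * (s - 1) \<le> y - k" if "(s, y) \<in> H" for s y
      using main[OF that] b by (simp add: field_simps)
  qed
qed

lemma lattice_pt_iff: "pt x y \<in> integer_lattice \<longleftrightarrow> x \<in> \<int> \<and> y \<in> \<int>"
  by (simp add: integer_lattice_def forall_2)

text \<open>The chord lengths of \<open>U\<close> in the horizontal direction form a convex region, to which the
  two lattice lines around the longest chords contribute one supporting line each. This bounds
  that region by a triangle.\<close>

lemma lattice_free_area_le:
  fixes U :: "(real^2) set"
  assumes U: "open U" "convex U" "bounded U" "U \<inter> integer_lattice = {}"
    and w: "1 < w" "\<And>v. v \<noteq> 0 \<Longrightarrow> \<exists>x\<in>U. \<exists>y\<in>U. w * norm v < v \<bullet> (x - y)"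
  shows "measure lborel U \<le> w\<^sup>2 / (2 * (w - 1))"
proof -
  define H where "H = {(s, y). \<exists>x. pt x y \<in> U \<and> pt (x + s) y \<in> U}"
  have H: "convex H"
  proof (rule convexI)
    fix z z' :: "real \<times> real" and u v :: real
    assume z: "z \<in> H" "z' \<in> H" and uv: "0 \<le> u" "0 \<le> v" "u + v = 1"
    obtain s y x where 1: "z = (s, y)" "pt x y \<in> U" "pt (x + s) y \<in> U"
      using z(1) by (auto simp: H_def)
    obtain s' y' x' where 2: "z' = (s', y')" "pt x' y' \<in> U" "pt (x' + s') y' \<in> U"
      using z(2) by (auto simp: H_def)
    have "u *\<^sub>R pt x y + v *\<^sub>R pt x' y' \<in> U"
      "u *\<^sub>R pt (x + s) y + v *\<^sub>R pt (x' + s') y' \<in> U"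
      using 1 2 U(2) uv by (auto intro: convexD)
    then show "u *\<^sub>R z + v *\<^sub>R z' \<in> H"
      unfolding 1 2 H_def pt_arith
      by (auto intro!: exI[of _ "u * x + v * x'"] simp: algebra_simps)
  qed
  \<comment> \<open>A chord longer than 1 at an integer height contains a lattice point: the first
    integer after \<open>x\<close> is at distance \<open>j \<le> 1 < s\<close>.\<close>
  have int: "s \<le> 1" if sk: "(s, of_int k) \<in> H" for s k
  proof (rule ccontr)
    assume s: "\<not> s \<le> 1"
    obtain x where x: "pt x (of_int k) \<in> U" "pt (x + s) (of_int k) \<in> U"
      using sk by (auto simp: H_def)
    define j where "j = of_int (floor x + 1) - x"
    have j: "0 < j" "j \<le> 1" unfolding j_def by linarith+
    have "(1 - j / s) *\<^sub>R pt x (of_int k) + (j / s) *\<^sub>R pt (x + s) (of_int k) \<in> U"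
      using x U(2) j s by (intro convexD) auto
    also have "(1 - j / s) *\<^sub>R pt x (of_int k) + (j / s) *\<^sub>R pt (x + s) (of_int k)
        = pt (of_int (floor x + 1)) (of_int k)"
    proof -
      have "(1 - j / s) * x + (j / s) * (x + s) = x + j" using s by (simp add: field_simps)
      moreover have "(1 - j / s) * of_int k + (j / s) * of_int k = of_int k" by (simp add: left_diff_distrib)
      ultimately show ?thesis by (simp add: pt_arith j_def)
    qed
    finally show False using U(4) lattice_pt_iff by fastforce
  qed
  \<comment> \<open>\<open>U\<close> has a horizontal chord of length \<open>w\<close>. Otherwise
    \<open>U\<close> and its translate by \<open>e\<close> are disjoint, and a hyperplane with
    normal \<open>a\<close> separating them bounds the width of \<open>U\<close> along
    \<open>a\<close> by \<open>w * norm a\<close>.\<close>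
  define e where "e = pt w 0"
  have "\<exists>x\<in>U. \<exists>y\<in>U. x - y = e"
  proof (rule ccontr)
    assume no: "\<not> ?thesis"
    define A where "A = (\<Union>x\<in>U. \<Union>y\<in>(+) e ` U. {x - y})"
    have "convex A" unfolding A_def using U(2) by (intro convex_differences convex_translation)
    moreover have "0 \<notin> A" using no by (auto simp: A_def algebra_simps)
    ultimately obtain a where a: "a \<noteq> 0" "\<forall>x\<in>A. 0 \<le> a \<bullet> x"
      using separating_hyperplane_set_0 by blast
    obtain x y where xy: "x \<in> U" "y \<in> U" "w * norm a < a \<bullet> (x - y)" using w(2)[OF a(1)] by blast
    have "y - (e + x) \<in> A" using xy by (auto simp: A_def)
    then have "0 \<le> a \<bullet> (y - (e + x))" using a by blast
    then have "a \<bullet> (x - y) \<le> - (a \<bullet> e)" by (simp add: inner_diff_right inner_add_right)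
    also have "\<dots> \<le> norm a * norm e" using Cauchy_Schwarz_ineq2[of a e] by linarith
    also have "norm e = w" using w(1) by (simp add: e_def pt_def)
    finally show False using xy by (simp add: mult.commute)
  qed
  then obtain x y where "x \<in> U" "y \<in> U" "x - y = e" by blast
  then have "pt (y$1) (y$2) \<in> U" "pt (y$1 + w) (y$2) \<in> U"
    using pt_eta[of y] pt_eta[of x] by (auto simp: e_def algebra_simps pt_arith)
  then obtain y0 where y0: "(w, y0) \<in> H" by (auto simp: H_def)
  define k where "k = floor y0"
  have "y0 \<noteq> of_int k" using int y0 w by force
  then have k: "of_int k < y0" "y0 < of_int k + 1"
    unfolding k_def by linarith+
  obtain p where p: "0 \<le> p" "\<And>s y. (s, y) \<in> H \<Longrightarrow> p * (s - 1) \<le> y - of_int k"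
    using supporting_slope[OF H y0 w(1) k(1)] int by blast
  \<comment> \<open>Reflection turns the upper lattice line \<open>k + 1\<close> into a lower one,
    so the same lemma gives the second supporting line.\<close>
  define H' where "H' = (\<lambda>(s, y). (s, - y)) ` H"
  have "convex H'"
    unfolding H'_def case_prod_unfold using H
    by (intro convex_linear_image) (auto intro!: linearI)
  moreover have "(w, - y0) \<in> H'" using y0 by (force simp: H'_def)
  moreover have "s \<le> 1" if "(s, - of_int k - 1) \<in> H'" for s
    using that int[of s "k + 1"] by (auto simp: H'_def algebra_simps minus_equation_iff)
  moreover have "- of_int k - 1 < - y0" using k(2) by simp
  ultimately obtain q where q: "0 \<le> q" "\<And>s y. (s, y) \<in> H' \<Longrightarrow> q * (s - 1) \<le> y - (- of_int k - 1)"
    using supporting_slope[of H' w "- y0" "- of_int k - 1"] w(1) by blast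
  then have q': "q * (s - 1) \<le> of_int k + 1 - y" if "(s, y) \<in> H" for s y
  proof -
    have "(s, - y) \<in> H'" using that by (force simp: H'_def)
    then show ?thesis using q(2) by fastforce
  qed
  \<comment> \<open>The vertical width of \<open>U\<close> gives \<open>w - 1 < m\<close>, by chords
    of length 0 at two heights; the chord of length \<open>w\<close> gives
    \<open>m * (w - 1) \<le> 1\<close>.\<close>
  define m where "m = p + q"
  obtain x y where "x \<in> U" "y \<in> U" "w < x$2 - y$2"
    using w(2)[of "axis 2 1"] by (auto simp: inner_axis inner_commute)
  have H0: "(0, z$2) \<in> H" if "z \<in> U" for z
    using that pt_eta[of z] by (auto simp: H_def intro!: exI[of _ "z$1"])
  have m1: "w - 1 < m"
    using p(2)[OF H0[OF \<open>y \<in> U\<close>]] q'[OF H0[OF \<open>x \<in> U\<close>]] \<open>w < x$2 - y$2\<close> by (simp add: m_def)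
  have m2: "m * (w - 1) \<le> 1"
    using p(2)[OF y0] q'[OF y0] by (simp add: m_def algebra_simps)
  have mpos: "0 < m" using m1 w by simp
  define T where "T = {(s, y). 0 \<le> s \<and> p * (s - 1) \<le> y - of_int k \<and> q * (s - 1) \<le> of_int k + 1 - y}"
  have "emeasure lborel U \<le> emeasure lborel T"
    unfolding T_def
  proof (rule emeasure_le_chords[OF U(1-3)])
    fix x s y assume "0 \<le> s" "pt x y \<in> U" "pt (x + s) y \<in> U"
    then have "(s, y) \<in> H" by (auto simp: H_def)
    then show "(s, y) \<in> {(s, y). 0 \<le> s \<and> p * (s - 1) \<le> y - of_int k \<and> q * (s - 1) \<le> of_int k + 1 - y}"
      using p q' \<open>0 \<le> s\<close> by auto
  qed (use emeasure_triangle(1)[OF p(1) q(1)] mpos in \<open>simp add: m_def\<close>)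
  also have "\<dots> = ennreal ((1 + m)\<^sup>2 / (2 * m))"
    unfolding T_def using emeasure_triangle(2)[OF p(1) q(1)] mpos by (simp add: m_def)
  finally have "measure lborel U \<le> (1 + m)\<^sup>2 / (2 * m)"
    unfolding measure_def using mpos by (simp add: enn2real_leI)
  \<comment> \<open>\<open>(1 + m)\<^sup>2 / m = m + 2 + 1 / m\<close> is convex and takes the value
    \<open>w\<^sup>2 / (w - 1)\<close> at both \<open>m = w - 1\<close> and
    \<open>m = 1 / (w - 1)\<close>, between which \<open>m\<close> lies.\<close>
  also have "\<dots> \<le> w\<^sup>2 / (2 * (w - 1))"
  proof -
    have "0 \<le> (m - (w - 1)) * (1 - m * (w - 1))" using m1 m2 by simp
    then have "(1 + m)\<^sup>2 * (w - 1) \<le> w\<^sup>2 * m" by (simp add: power2_eq_square algebra_simps)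
    then show ?thesis using mpos w by (simp add: divide_le_eq pos_le_divide_eq field_simps)
  qed
  finally show ?thesis .
qed

section \<open>Scott's inequality and the upper bounds\<close>

lemma content_triangle_perp:
  "measure lebesgue (convex hull {P, Q, A}) = \<bar>perp (Q - P) \<bullet> (A - P)\<bar> / 2"
proof -
  have "convex hull {P, Q, A} \<in> sets borel"
    by (intro borel_compact finite_imp_compact_convex_hull) auto
  then have "measure lebesgue (convex hull {P, Q, A}) = measure lborel (convex hull {P, Q, A})"
    by (simp add: measure_completion)
  then show ?thesis unfolding content_triangle
    by (simp add: inner_real2 algebra_simps abs_minus_commute)
qed

text \<open>The triangles \<open>PQA\<close> and \<open>PQB\<close> lie on opposite sides of the
  line \<open>PQ\<close> and overlap in a null set, so their areas add up inside
  \<open>K\<close>.\<close>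

lemma quadrilateral_area_le:
  fixes K :: "(real^2) set"
  assumes K: "convex K" "compact K" "P \<in> K" "Q \<in> K" "A \<in> K" "B \<in> K" "P \<noteq> Q"
  defines "v \<equiv> perp (Q - P)"
  assumes AB: "v \<bullet> B \<le> v \<bullet> P" "v \<bullet> P \<le> v \<bullet> A"
  shows "v \<bullet> (A - B) / 2 \<le> measure lebesgue K"
proof -
  define S T where "S = convex hull {P, Q, A}" and "T = convex hull {P, Q, B}"
  have m: "S \<in> lmeasurable" "T \<in> lmeasurable" "K \<in> lmeasurable"
    unfolding S_def T_def using K
    by (auto intro!: lmeasurable_compact finite_imp_compact_convex_hull)
  have vQ: "v \<bullet> Q = v \<bullet> P" by (simp add: v_def inner_real2 algebra_simps)
  have "S \<subseteq> {z. v \<bullet> z \<ge> v \<bullet> P}"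
    unfolding S_def using AB vQ by (intro hull_minimal convex_halfspace_ge) auto
  moreover have "T \<subseteq> {z. v \<bullet> z \<le> v \<bullet> P}"
    unfolding T_def using AB vQ by (intro hull_minimal convex_halfspace_le) auto
  ultimately have "S \<inter> T \<subseteq> {z. v \<bullet> z = v \<bullet> P}" by force
  moreover have "negligible {z. v \<bullet> z = v \<bullet> P}"
    using K(7) by (intro negligible_hyperplane) (simp add: v_def)
  ultimately have neg: "negligible (S \<inter> T)" by (rule negligible_subset[rotated])
  have "measure lebesgue S + measure lebesgue T = measure lebesgue (S \<union> T)"
    using measure_Un3_negligible[OF m(1,2), of "{}"] neg by simp
  also have "\<dots> \<le> measure lebesgue K"
  proof (rule measure_mono_fmeasurable)
    show "S \<union> T \<subseteq> K" unfolding S_def T_def using K by (intro Un_least hull_minimal) auto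
  qed (use m in auto)
  finally show ?thesis
    unfolding S_def T_def content_triangle_perp
    using AB by (simp add: v_def inner_diff_right abs_if field_simps split: if_splits)
qed

text \<open>Scott's inequality. If all widths exceed \<open>w = D / (D - 1)\<close>, the lattice
  condition bounds the area by \<open>w * D / 2\<close>. A diameter together with the extreme points
  perpendicular to it spans a larger area.\<close>

lemma exists_narrow_direction:
  fixes K :: "(real^2) set"
  assumes K: "convex K" "compact K" "interior K \<noteq> {}" "lattice_free K" and D: "1 < diameter K"
  obtains n where "norm n = 1"
    "\<And>x y. x \<in> K \<Longrightarrow> y \<in> K \<Longrightarrow> n \<bullet> (x - y) \<le> diameter K / (diameter K - 1)"
proof (rule ccontr)
  note narrow = that
  assume no: "\<not> thesis"
  define D where "D = diameter K"
  define w where "w = D / (D - 1)"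
  have D1: "1 < D" using D by (simp add: D_def)
  have w: "1 < w" "w / (w - 1) = D" using D1 by (auto simp: w_def field_simps)
  have bK: "bounded K" using K compact_imp_bounded by auto
  have wide: "\<exists>x\<in>K. \<exists>y\<in>K. w * norm v < v \<bullet> (x - y)" if "v \<noteq> 0" for v
  proof -
    have "norm (v /\<^sub>R norm v) = 1" using that by simp
    then obtain x y where xy: "x \<in> K" "y \<in> K" "w < (v /\<^sub>R norm v) \<bullet> (x - y)"
      using no narrow[of "v /\<^sub>R norm v"] unfolding w_def D_def by (meson not_le)
    then have "w * norm v < v \<bullet> (x - y)" using that by (simp add: field_simps)
    then show ?thesis using xy by blast
  qed
  define U where "U = interior K"
  have cl: "K \<subseteq> closure U"
    unfolding U_def using K convex_closure_interior closure_subset by blast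
  have wideU: "\<exists>x\<in>U. \<exists>y\<in>U. w * norm v < v \<bullet> (x - y)" if v: "v \<noteq> 0" for v
  proof -
    obtain x y where xy: "x \<in> K" "y \<in> K" "w * norm v < v \<bullet> (x - y)" using wide[OF v] by blast
    \<comment> \<open>Moving \<open>x\<close> and \<open>y\<close> into the interior costs less than
      half of the slack each.\<close>
    define e where "e = (v \<bullet> (x - y) - w * norm v) / (2 * norm v)"
    have e: "e > 0" "2 * (norm v * e) = v \<bullet> (x - y) - w * norm v"
      using xy v by (auto simp: e_def)
    obtain x' where x': "x' \<in> U" "dist x' x < e" using cl xy(1) e closure_approachable by blast
    obtain y' where y': "y' \<in> U" "dist y' y < e" using cl xy(2) e closure_approachable by blast
    have "v \<bullet> (x - x') \<le> norm v * norm (x - x')" "v \<bullet> (y' - y) \<le> norm v * norm (y' - y)"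
      by (rule norm_cauchy_schwarz)+
    moreover have "norm v * norm (x - x') < norm v * e" "norm v * norm (y' - y) < norm v * e"
      using x' y' v by (auto simp: dist_norm norm_minus_commute)
    ultimately have "w * norm v < v \<bullet> (x' - y')"
      using e by (simp add: inner_diff_right)
    then show ?thesis using x' y' by blast
  qed
  have "measure lborel U \<le> w\<^sup>2 / (2 * (w - 1))"
    using K bK w(1) wideU unfolding U_def
    by (intro lattice_free_area_le) (auto simp: lattice_free_def intro: bounded_interior)
  also have "\<dots> = w * (w / (w - 1)) / 2" by (simp add: power2_eq_square)
  also have "\<dots> = w * D / 2" by (simp only: w(2))
  also have "measure lborel U = measure lebesgue U"
    by (simp add: measure_completion U_def)
  also have "\<dots> = measure lebesgue K"
    unfolding U_def by (intro measure_interior bK negligible_convex_frontier K)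
  finally have le: "measure lebesgue K \<le> w * D / 2" .
  obtain P Q where PQ: "P \<in> K" "Q \<in> K" "dist P Q = D"
    using diameter_compact_attained[OF K(2)] K interior_subset unfolding D_def by blast
  define v where "v = perp (Q - P)"
  have nv: "norm v = D" "v \<noteq> 0" "P \<noteq> Q"
    using PQ(3) D1 by (auto simp: v_def dist_norm norm_minus_commute)
  have cv: "continuous_on K ((\<bullet>) v)" by (intro continuous_intros)
  obtain A where A: "A \<in> K" "\<And>z. z \<in> K \<Longrightarrow> v \<bullet> z \<le> v \<bullet> A"
    using continuous_attains_sup[OF K(2) _ cv] PQ by blast
  obtain B where B: "B \<in> K" "\<And>z. z \<in> K \<Longrightarrow> v \<bullet> B \<le> v \<bullet> z"
    using continuous_attains_inf[OF K(2) _ cv] PQ by blast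
  obtain x y where "x \<in> K" "y \<in> K" "w * D < v \<bullet> (x - y)" using wide[OF nv(2)] nv by auto
  moreover have "v \<bullet> (x - y) \<le> v \<bullet> (A - B)"
    using A(2)[OF \<open>x \<in> K\<close>] B(2)[OF \<open>y \<in> K\<close>] by (simp add: inner_diff_right)
  moreover have "v \<bullet> (A - B) / 2 \<le> measure lebesgue K"
    using quadrilateral_area_le[OF K(1,2) PQ(1,2) A(1) B(1) nv(3)] A(2) B(2) PQ by (simp add: v_def)
  ultimately show False using le by simp
qed

section \<open>Perimeter bounds in terms of diameter and circumradius\<close>

lemma diameter_le_2_circumradius:
  fixes K :: "(real^2) set"
  assumes "bounded K" "K \<noteq> {}"
  shows "diameter K \<le> 2 * circumradius K"
proof -
  have "diameter K / 2 \<le> circumradius K" unfolding circumradius_def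
  proof (rule cInf_greatest)
    show "{r. \<exists>c. K \<subseteq> cball c r} \<noteq> {}"
      using assms(1) unfolding bounded_subset_cball by blast
    fix r assume "r \<in> {r. \<exists>c. K \<subseteq> cball c r}"
    then obtain c where c: "K \<subseteq> cball c r" by auto
    have "diameter K \<le> 2 * r"
    proof (rule diameter_le)
      fix x y assume "x \<in> K" "y \<in> K"
      then have "dist c x \<le> r" "dist c y \<le> r" using c by auto
      then have "dist x y \<le> 2 * r" using dist_triangle3[of x y c] by linarith
      then show "norm (x - y) \<le> 2 * r" by (simp add: dist_norm)
    qed (use assms in auto)
    then show "diameter K / 2 \<le> r" by simp
  qed
  then show ?thesis by simp
qed

lemma circumradius_le:
  fixes K :: "(real^2) set"
  assumes "K \<noteq> {}" "K \<subseteq> cball c r"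
  shows "circumradius K \<le> r"
  unfolding circumradius_def
proof (rule cInf_lower)
  obtain x where "x \<in> K" using assms by blast
  \<comment> \<open>A ball of negative radius is empty and cannot contain the nonempty
    \<open>K\<close>.\<close>
  have "0 \<le> s" if "K \<subseteq> cball c s" for c s
    using \<open>x \<in> K\<close> that by (metis mem_cball order_trans subsetD zero_le_dist)
  then show "bdd_below {r. \<exists>c. K \<subseteq> cball c r}" by (auto intro!: bdd_belowI)
qed (use assms in auto)

lemma perimeter_less_4_diameter:
  fixes K :: "(real^2) set"
  assumes K: "convex K" "compact K" "x \<in> K" "y \<in> K" "x \<noteq> y"
  shows "perimeter K < 4 * diameter K"
proof -
  have bK: "bounded K" using K compact_imp_bounded by auto
  have n: "norm (axis 1 1 :: real^2) = 1" by simp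
  have "axis 1 1 \<bullet> (x - y) \<le> diameter K" if "x \<in> K" "y \<in> K" for x y
    using norm_cauchy_schwarz[of "axis 1 1" "x - y"] diameter_bounded_bound[OF bK that] n
    by (simp add: dist_norm)
  then show ?thesis
    using perimeter_less[OF K n diameter_pos[OF bK K(3-5)]] by simp
qed

lemma scott_perimeter_bound:
  fixes K :: "(real^2) set"
  assumes K: "convex K" "compact K" "x \<in> K" "y \<in> K" "x \<noteq> y" "lattice_free K"
    and D: "1 < diameter K"
  shows "perimeter K < 2 * diameter K + 2 * (diameter K / (diameter K - 1))"
proof (cases "interior K = {}")
  case True
  then show ?thesis using D by (simp add: perimeter_def)
next
  case False
  obtain n where n: "norm n = 1"
    "\<And>x y. x \<in> K \<Longrightarrow> y \<in> K \<Longrightarrow> n \<bullet> (x - y) \<le> diameter K / (diameter K - 1)"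
    using exists_narrow_direction[OF K(1,2) False K(6) D] by metis
  then show ?thesis using perimeter_less[OF K(1-5) n(1) _ n(2)] D by simp
qed

text \<open>Shared by (i) with \<open>x = D\<close> and (ii) with \<open>x = 2 R\<close>. For
  \<open>x > 1\<close> the factor cancels \<open>x / (x - 1)\<close>; for \<open>x \<le> 1\<close>
  it is nonpositive, and \<open>p \<ge> 0\<close> leaves \<open>2 - 2 * x\<close>.\<close>

lemma excess_bound:
  fixes x p :: real
  assumes "0 < x" "0 \<le> p" "1 < x \<Longrightarrow> p < 2 * x + 2 * (x / (x - 1))"
  shows "(x - 1) / x * (p - 2 * x) < 2"
proof (cases "1 < x")
  case True
  then have "(x - 1) / x * (p - 2 * x) < (x - 1) / x * (2 * (x / (x - 1)))"
    using assms by (intro mult_strict_left_mono) auto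
  also have "\<dots> = 2" using True by (simp add: field_simps)
  finally show ?thesis .
next
  case False
  have "(x - 1) / x * (p - 2 * x) \<le> (x - 1) / x * (- 2 * x)"
    using False assms by (intro mult_left_mono_neg) (auto simp: divide_le_0_iff)
  also have "\<dots> = 2 - 2 * x" using assms by (simp add: field_simps)
  finally show ?thesis using assms by simp
qed

lemma diameter_excess_bound:
  assumes "K \<in> nontrivial_lattice_free_bodies"
  shows "(diameter K - 1) / diameter K * (perimeter K - 2 * diameter K) < 2"
proof -
  obtain x y where K: "convex K" "compact K" "x \<in> K" "y \<in> K" "x \<noteq> y" "lattice_free K"
    using assms by (auto simp: nontrivial_lattice_free_bodies_def)
  show ?thesis
    using diameter_pos[OF compact_imp_bounded[OF K(2)] K(3-5)] perimeter_nonneg[OF K(1,2)]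
      scott_perimeter_bound[OF K] by (rule excess_bound)
qed

lemma circumradius_excess_bound:
  assumes "K \<in> nontrivial_lattice_free_bodies"
  shows "(2 * circumradius K - 1) / (2 * circumradius K) * (perimeter K - 4 * circumradius K) < 2"
proof -
  obtain x y where K: "convex K" "compact K" "x \<in> K" "y \<in> K" "x \<noteq> y" "lattice_free K"
    using assms by (auto simp: nontrivial_lattice_free_bodies_def)
  define D r where "D = diameter K" and "r = 2 * circumradius K"
  have D: "0 < D" unfolding D_def
    using diameter_pos[OF compact_imp_bounded[OF K(2)] K(3-5)] .
  have Dr: "D \<le> r" unfolding D_def r_def
    using diameter_le_2_circumradius[OF compact_imp_bounded[OF K(2)]] K(3) by blast
  have "perimeter K < 2 * r + 2 * (r / (r - 1))" if r: "1 < r"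
  proof (cases "2 \<le> D")
    case True
    have "perimeter K < 2 * D + 2 * (D / (D - 1))"
      unfolding D_def using scott_perimeter_bound[OF K] True by (simp add: D_def)
    also have "\<dots> \<le> 2 * r + 2 * (r / (r - 1))"
    proof -
      \<comment> \<open>Monotonicity from 2 on: the decrease of \<open>x / (x - 1)\<close> between
        \<open>D\<close> and \<open>r\<close> is at most \<open>r - D\<close>.\<close>
      have "1 / ((D - 1) * (r - 1)) \<le> 1"
        using True Dr mult_mono[of 1 "D - 1" 1 "r - 1"] by simp
      then have "(r - D) * (1 / ((D - 1) * (r - 1))) \<le> (r - D) * 1"
        using Dr by (intro mult_left_mono) auto
      moreover have "D / (D - 1) - r / (r - 1) = (r - D) * (1 / ((D - 1) * (r - 1)))"
        using True r by (simp add: field_simps)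
      ultimately show ?thesis by simp
    qed
    finally show ?thesis .
  next
    case False
    have "perimeter K < 8" using perimeter_less_4_diameter[OF K(1-5)] False by (simp add: D_def)
    \<comment> \<open>The difference of the two sides below is
      \<open>2 * (r - 2)\<^sup>2 / (r - 1)\<close>.\<close>
    also have "0 \<le> (r - 2)\<^sup>2" by simp
    then have "8 \<le> 2 * r + 2 * (r / (r - 1))"
      using r by (simp add: field_simps power2_eq_square)
    finally show ?thesis .
  qed
  moreover have "0 < r" using D Dr by simp
  ultimately have "(r - 1) / r * (perimeter K - 2 * r) < 2"
    using perimeter_nonneg[OF K(1,2)] by (intro excess_bound) auto
  then show ?thesis by (simp add: r_def)
qed

section \<open>Long rectangles\<close>

lemma dist_pt: "dist (pt x y) (pt x' y') = sqrt ((x - x')\<^sup>2 + (y - y')\<^sup>2)"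
  by (simp add: dist_norm norm_eq_sqrt_inner inner_real2 pt_arith power2_eq_square)

text \<open>The partition \<open>0, a, b, c, d, 1\<close> has five steps. As
  \<open>g 0 = g 1\<close>, its first and last steps together dominate the closing distance from
  \<open>g d\<close> to \<open>g a\<close>.\<close>

lemma closed_tour_le:
  fixes g :: "real \<Rightarrow> 'a::metric_space"
  assumes L: "\<And>N t. t 0 = 0 \<Longrightarrow> t N = 1 \<Longrightarrow> mono_on {..N} t \<Longrightarrow>
      (\<Sum>i<N. dist (g (t i)) (g (t (Suc i)))) \<le> L"
    and g: "g 0 = g 1" and s: "0 \<le> a" "a \<le> b" "b \<le> c" "c \<le> d" "d \<le> 1"
  shows "dist (g a) (g b) + dist (g b) (g c) + dist (g c) (g d) + dist (g d) (g a) \<le> L"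
proof -
  define xs where "xs = [0, a, b, c, d, 1]"
  have "sorted xs" using s by (simp add: xs_def)
  then have "mono_on {..5} ((!) xs)"
    by (auto simp: mono_on_def xs_def intro!: sorted_nth_mono)
  then have "(\<Sum>i<5. dist (g (xs ! i)) (g (xs ! Suc i))) \<le> L"
    by (intro L) (simp_all add: xs_def)
  then have "dist (g 0) (g a) + dist (g a) (g b) + dist (g b) (g c) + dist (g c) (g d) + dist (g d) (g 1) \<le> L"
    by (simp add: xs_def eval_nat_numeral)
  moreover have "dist (g d) (g a) \<le> dist (g d) (g 1) + dist (g 0) (g a)"
    unfolding g by (rule dist_triangle)
  ultimately show ?thesis by linarith
qed

lemma sorted_enumeration_4:
  fixes S :: "real set"
  assumes "card S = 4"
  obtains a b c d where "S = {a, b, c, d}" "a < b" "b < c" "c < d"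
proof -
  have fin: "finite S" using assms card.infinite by fastforce
  obtain xs where xs: "set xs = S" "sorted_wrt (<) xs" "length xs = 4"
    using that assms fin by (metis strict_sorted_list_of_set set_sorted_list_of_set length_sorted_list_of_set)
  then obtain a b c d where "xs = [a, b, c, d]"
    by (auto simp: eval_nat_numeral length_Suc_conv)
  with xs that show ?thesis by auto
qed

text \<open>At each corner, a tour uses two of the three distances to the other corners, whose sum is at
  least \<open>N + 1\<close>.\<close>

lemma rectangle_perimeter_ge:
  fixes N :: real
  assumes N: "1 \<le> N"
  shows "2 * N + 2 \<le> perimeter (cbox (pt 0 0) (pt N 1))"
proof -
  define K where "K = cbox (pt 0 0) (pt N 1)"
  have int: "interior K = box (pt 0 0) (pt N 1)" by (simp add: K_def interior_cbox)
  have ne: "interior K \<noteq> {}"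
    unfolding int using N by (auto simp: box_ne_empty Basis_real2 inner_axis)
  obtain g where g: "boundary_parametrization K g" and L: "\<And>n t. t 0 = 0 \<Longrightarrow> t n = 1 \<Longrightarrow>
      mono_on {..n} t \<Longrightarrow> (\<Sum>i<n. dist (g (t i)) (g (t (Suc i)))) \<le> perimeter K"
    using inscribed_length_le_perimeter[of K] ne by (auto simp: K_def convex_box compact_cbox)
  have g01: "g 0 = g 1" using g by (simp add: boundary_parametrization_def pathstart_def pathfinish_def)
  define V where "V = {pt 0 0, pt N 0, pt N 1, pt 0 1}"
  have "V \<subseteq> K" "V \<inter> interior K = {}"
    unfolding V_def int using N by (auto simp: K_def mem_box_cart forall_2)
  then have "V \<subseteq> frontier K" by (auto simp: frontier_def intro: closure_subset[THEN subsetD])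
  then have "V \<subseteq> g ` {0..1}" using g by (simp add: boundary_parametrization_def path_image_def)
  \<comment> \<open>One parameter per corner: the corner where \<open>g\<close> starts has
    two.\<close>
  then obtain S where S: "S \<subseteq> {0..1}" "inj_on g S" "V = g ` S"
    using subset_image_inj by metis
  have pt_eq: "pt x y = pt x' y' \<longleftrightarrow> x = x' \<and> y = y'" for x y x' y'
    by (simp add: real2_eq_iff)
  have "card V = 4" using N by (simp add: V_def pt_eq)
  then have "card S = 4" using S card_image by metis
  then obtain a b c d where abcd: "S = {a, b, c, d}" "a < b" "b < c" "c < d"
    using sorted_enumeration_4 by blast
  have "dist (g a) (g b) + dist (g b) (g c) + dist (g c) (g d) + dist (g d) (g a) \<le> perimeter K"
    using S(1) abcd by (intro closed_tour_le[OF L g01]) auto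
  \<comment> \<open>The order in which \<open>g\<close> visits the corners is unknown, so any two
    neighbours are allowed. Summing over the four corners counts every distance of the tour
    twice.\<close>
  moreover have corner: "N + 1 \<le> dist x y + dist y z"
    if "x \<in> V" "y \<in> V" "z \<in> V" "x \<noteq> y" "y \<noteq> z" "x \<noteq> z" for x y z
  proof -
    have "N \<le> sqrt (N\<^sup>2 + 1)" using N by (simp add: real_le_rsqrt)
    moreover have "1 \<le> sqrt (N\<^sup>2 + 1)" by simp
    ultimately show ?thesis
      using that N unfolding V_def by (auto simp: dist_pt)
  qed
  have V: "g a \<in> V" "g b \<in> V" "g c \<in> V" "g d \<in> V" using S abcd by auto
  have "g a \<noteq> g b" "g a \<noteq> g c" "g a \<noteq> g d" "g b \<noteq> g c" "g b \<noteq> g d" "g c \<noteq> g d"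
    using S(2) abcd by (auto simp: inj_on_def)
  then have "N + 1 \<le> dist (g a) (g b) + dist (g b) (g c)" "N + 1 \<le> dist (g b) (g c) + dist (g c) (g d)"
    "N + 1 \<le> dist (g c) (g d) + dist (g d) (g a)" "N + 1 \<le> dist (g d) (g a) + dist (g a) (g b)"
    using V by (auto intro!: corner)
  ultimately show ?thesis unfolding K_def by linarith
qed

text \<open>The diagonal is at most \<open>D\<close>, and \<open>D \<le> 2 R\<close>; the disk about
  the centre through the corners shows that \<open>2 R\<close> is at most the diagonal, so all three
  agree.\<close>

lemma rectangle_extremal:
  fixes N :: real
  assumes N: "1 \<le> N"
  defines "K \<equiv> cbox (pt 0 0) (pt N 1)"
  shows "K \<in> nontrivial_lattice_free_bodies" "diameter K = sqrt (N\<^sup>2 + 1)"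
    "2 * circumradius K = sqrt (N\<^sup>2 + 1)"
proof -
  have corners: "pt 0 0 \<in> K" "pt N 1 \<in> K" "pt 0 0 \<noteq> pt N 1"
    using N by (auto simp: K_def mem_box_cart forall_2 real2_eq_iff)
  have "interior K \<inter> integer_lattice = {}"
  proof -
    have False if "0 < z $ 2" "z $ 2 < 1" "z $ 2 \<in> \<int>" for z :: "real^2"
      using that by (auto elim!: Ints_cases)
    then show ?thesis
      unfolding K_def interior_cbox by (auto simp: mem_box_cart forall_2 integer_lattice_def)
  qed
  then show "K \<in> nontrivial_lattice_free_bodies"
    using corners unfolding nontrivial_lattice_free_bodies_def lattice_free_def K_def
    by (auto simp: convex_box compact_cbox)
  have bK: "bounded K" by (simp add: K_def bounded_cbox)
  have lower: "sqrt (N\<^sup>2 + 1) \<le> diameter K"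
    using diameter_bounded_bound[OF bK corners(1,2)] by (simp add: dist_pt)
  have "K \<subseteq> cball (pt (N / 2) (1 / 2)) (sqrt (N\<^sup>2 + 1) / 2)"
  proof
    fix z assume "z \<in> K"
    then have z: "0 \<le> z$1" "z$1 \<le> N" "0 \<le> z$2" "z$2 \<le> 1"
      by (auto simp: K_def mem_box_cart forall_2)
    have "\<bar>N / 2 - z$1\<bar> \<le> \<bar>N / 2\<bar>" "\<bar>1 / 2 - z$2\<bar> \<le> \<bar>1 / 2\<bar>"
      using z by linarith+
    then have "(N / 2 - z$1)\<^sup>2 \<le> (N / 2)\<^sup>2" "(1 / 2 - z$2)\<^sup>2 \<le> (1 / 2)\<^sup>2"
      by (simp_all only: abs_le_square_iff)
    then have "(N / 2 - z$1)\<^sup>2 + (1 / 2 - z$2)\<^sup>2 \<le> (N\<^sup>2 + 1) / 4"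
      by (simp add: power_divide)
    then have "sqrt ((N / 2 - z$1)\<^sup>2 + (1 / 2 - z$2)\<^sup>2) \<le> sqrt ((N\<^sup>2 + 1) / 4)"
      by (rule real_sqrt_le_mono)
    then show "z \<in> cball (pt (N / 2) (1 / 2)) (sqrt (N\<^sup>2 + 1) / 2)"
      by (subst pt_eta[of z]) (simp add: dist_pt real_sqrt_divide)
  qed
  then have "circumradius K \<le> sqrt (N\<^sup>2 + 1) / 2"
    using corners by (intro circumradius_le) auto
  moreover have "diameter K \<le> 2 * circumradius K"
    using diameter_le_2_circumradius[OF bK] corners by blast
  ultimately show "diameter K = sqrt (N\<^sup>2 + 1)" "2 * circumradius K = sqrt (N\<^sup>2 + 1)"
    using lower by linarith+
qed

lemma rectangle_excess_large:
  fixes c :: real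
  assumes "c < 2"
  obtains K where "K \<in> nontrivial_lattice_free_bodies" "2 * circumradius K = diameter K"
    "c < (diameter K - 1) / diameter K * (perimeter K - 2 * diameter K)"
proof -
  define f :: "real \<Rightarrow> real" where "f N = (sqrt (N\<^sup>2 + 1) - 1) / sqrt (N\<^sup>2 + 1) * (2 * N + 2 - 2 * sqrt (N\<^sup>2 + 1))" for N
  \<comment> \<open>The first factor tends to 1 and \<open>2 * N - 2 * sqrt (N\<^sup>2 + 1)\<close>
    to 0.\<close>
  have "(f \<longlongrightarrow> 2) at_top" unfolding f_def by real_asymp
  then have "eventually (\<lambda>N. c < f N) at_top" using assms by (rule order_tendstoD)
  then have "eventually (\<lambda>N. c < f N \<and> 1 \<le> N) at_top"
    using eventually_ge_at_top[of 1] by eventually_elim simp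
  then obtain N where N: "c < f N" "1 \<le> N"
    unfolding eventually_at_top_linorder by blast
  define K where "K = cbox (pt 0 0) (pt N 1)"
  note R = rectangle_extremal[OF N(2), folded K_def]
  have "f N \<le> (diameter K - 1) / diameter K * (perimeter K - 2 * diameter K)"
    unfolding f_def R(2)
    using rectangle_perimeter_ge[OF N(2)]
    by (intro mult_left_mono divide_nonneg_nonneg) (auto simp: K_def)
  then show ?thesis using that R N by force
qed

theorem theorem1p3:
  shows "(\<forall>K \<in> nontrivial_lattice_free_bodies.
            (diameter K - 1) / diameter K * (perimeter K - 2 * diameter K) < 2) \<and>
         (\<forall>K \<in> nontrivial_lattice_free_bodies.
            (2 * circumradius K - 1) / (2 * circumradius K) * (perimeter K - 4 * circumradius K) < 2) \<and>
         \<not> (\<exists>c<2. \<forall>K \<in> nontrivial_lattice_free_bodies.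
            (diameter K - 1) / diameter K * (perimeter K - 2 * diameter K) < c) \<and>
         \<not> (\<exists>c<2. \<forall>K \<in> nontrivial_lattice_free_bodies.
            (2 * circumradius K - 1) / (2 * circumradius K) * (perimeter K - 4 * circumradius K) < c)"
proof (intro conjI ballI notI; (elim exE conjE)?)
  fix c :: real
  assume "c < 2"
  then obtain K where K: "K \<in> nontrivial_lattice_free_bodies" "2 * circumradius K = diameter K"
    "c < (diameter K - 1) / diameter K * (perimeter K - 2 * diameter K)"
    using rectangle_excess_large by blast
  \<comment> \<open>As \<open>2 R = D\<close> for this rectangle, the left-hand sides of (i) and
    (ii) coincide on it, and one \<open>K\<close> refutes \<open>c\<close> for both.\<close>
  have eq: "4 * circumradius K = 2 * diameter K" using K(2) by simp
  show False if "\<forall>K \<in> nontrivial_lattice_free_bodies.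
            (diameter K - 1) / diameter K * (perimeter K - 2 * diameter K) < c"
    using bspec[OF that K(1)] K(3) by linarith
  show False if "\<forall>K \<in> nontrivial_lattice_free_bodies.
            (2 * circumradius K - 1) / (2 * circumradius K) * (perimeter K - 4 * circumradius K) < c"
    using bspec[OF that K(1)] K(3) unfolding K(2) eq by linarith
qed (fact diameter_excess_bound circumradius_excess_bound)+

end
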